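(* Let $c_k=\left(\sqrt{k^2-1}\right)^{\frac12\left(1-\frac1k\right)}k^{\frac1{2k}}$ and $\lambda=\frac{k(k-1)}{n-1}$. If $k=o(n^{1/3})$, then for $n$ sufficiently large, $$c_k^{\,n}<k\,(k-\lambda)^{(n-1)/2}.$$
   Context: Here $n$ and $k$ are positive integers with $k\le n$, where $k=k(n)$ may depend on $n$; the condition $k=o(n^{1/3})$ means $k(n)/n^{1/3}\to0$ as $n\to\infty$.
   Formalization: For k = 1 the constant c_k contains 0^0; with 0^0 = 1 the claim would read 1 < 1 and fail, so here 0^0 is read as 0, giving c_1 = 0; for k ≥ 2 the claim is unchanged. *)

theory Defs
  imports Complex_Main "HOL-Library.Landau_Symbols"
begin

(* For k = 1 the first factor is the formal expression 0 to the power 0, which the library's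
   powr evaluates to 0, so that c_const 1 = 0. With the opposite convention (value 1) one would
   have c_const 1 = 1, and the strict inequality c_k ^ n < k * (k - lambda) powr ((n - 1) / 2)
   would read 1 < 1 at k = 1. For k \<ge> 2 both bases in c_const are positive. *)
definition c_const :: "nat \<Rightarrow> real" where
  "c_const k =
     sqrt ((real k)\<^sup>2 - 1) powr (1 / 2 * (1 - 1 / real k)) * real k powr (1 / (2 * real k))"

definition lambda_param :: "nat \<Rightarrow> nat \<Rightarrow> real" where
  "lambda_param n k = real k * (real k - 1) / (real n - 1)"

end

theory Submission
  imports Defs
begin

text \<open>
  Since \<open>ln (k\<^sup>2 - 1) = 2 ln k + ln (1 - 1/k\<^sup>2)\<close>, the two factors of \<open>c_const k\<close> combine to
  \<open>c_const k = sqrt k * (1 - 1/k\<^sup>2) powr ((1 - 1/k) / 4)\<close>; this is \<open>ln_c_const\<close>. On the other side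
  \<open>k - \<lambda> = k (1 - x)\<close> with \<open>x = (k - 1) / (n - 1)\<close>. Taking logarithms, the main terms
  \<open>(n / 2) ln k\<close> cancel, and for \<open>k \<ge> 2\<close> the claim becomes
  \<open>(n / 4) (1 - 1/k) ln (1 - 1/k\<^sup>2) < (ln k) / 2 + ((n - 1) / 2) ln (1 - x)\<close>.

  The left-hand side is at most \<open>- n (k - 1) / (4 k\<^sup>3)\<close>, while the second term on the right is at
  least \<open>- (k - 1) (n - 1) / (2 (n - k))\<close>, roughly \<open>- (k - 1) / 2\<close>. So the gain of order
  \<open>n / k\<^sup>2\<close> on the left beats the loss of order \<open>k\<close> on the right as soon as \<open>k\<^sup>3\<close> is below a fixed
  fraction of \<open>n\<close>, which is where the exponent \<open>1/3\<close> comes from. The positive term \<open>(ln k) / 2\<close>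
  makes the inequality strict. The case \<open>k = 1\<close> is separate: there the left-hand side is \<open>0\<close>
  and the right-hand side is \<open>1\<close>.
\<close>

lemma ln_c_const:
  assumes "k \<ge> 2"
  shows "ln (c_const k) = ln (real k) / 2 + (1 - 1 / real k) * ln (1 - 1 / (real k)\<^sup>2) / 4"
proof -
  define K where "K = real k"
  have K: "K \<ge> 2" using assms by (simp add: K_def)
  then have K2: "K\<^sup>2 > 1" by (simp add: one_less_power)
  have "ln (c_const k) = (1 / 2 * (1 - 1 / K)) * (ln (K\<^sup>2 - 1) / 2) + ln K / (2 * K)"
    using K K2 less_imp_neq[OF K2]
    by (simp add: c_const_def K_def[symmetric] ln_mult ln_powr ln_sqrt)
  also have "ln (K\<^sup>2 - 1) = ln (K\<^sup>2 * (1 - 1 / K\<^sup>2))"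
    using K by (simp add: field_simps)
  also have "\<dots> = 2 * ln K + ln (1 - 1 / K\<^sup>2)"
    using K K2 less_imp_neq[OF K2] by (simp add: ln_mult ln_realpow)
  finally show ?thesis
    using K unfolding K_def[symmetric] by (simp add: field_simps)
qed

lemma ln_one_minus_ge:
  fixes x :: real
  assumes "x < 1"
  shows "- (x / (1 - x)) \<le> ln (1 - x)"
proof -
  have "ln (inverse (1 - x)) \<le> inverse (1 - x) - 1"
    using assms by (intro ln_le_minus_one) simp
  moreover have "inverse (1 - x) - 1 = x / (1 - x)"
    using assms by (simp add: field_simps)
  ultimately show ?thesis
    using assms by (simp add: ln_inverse)
qed

text \<open>
  The gain \<open>n (k - 1) / (4 k\<^sup>3)\<close> dominates the loss \<open>(k - 1) (n - 1) / (2 (n - k))\<close> because, after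
  clearing denominators, it amounts to \<open>2 k\<^sup>3 (n - 1) \<le> n (n - k)\<close>: the hypothesis bounds the left
  side by \<open>n (n - 1) / 2\<close>, and it forces \<open>k \<le> n / 2\<close>.
\<close>

lemma loss_le_gain:
  fixes K N :: real
  assumes K: "K \<ge> 2" and N: "4 * K ^ 3 \<le> N"
  shows "(K - 1) * (N - 1) / (2 * (N - K)) \<le> N * (K - 1) / (4 * K ^ 3)"
proof -
  have "K ^ 1 \<le> K ^ 3" using K by (intro power_increasing) auto
  then have NK: "2 * K \<le> N" using K N by simp
  have "4 * K ^ 3 * (N - 1) \<le> N * (N - 1)"
    using N K NK by (intro mult_right_mono) auto
  also have "\<dots> \<le> N * (2 * (N - K))"
    using NK K by (intro mult_left_mono) auto
  finally have "(K - 1) * (4 * K ^ 3 * (N - 1)) \<le> (K - 1) * (N * (2 * (N - K)))"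
    using K by (intro mult_left_mono) auto
  then show ?thesis
    using K NK by (simp add: field_simps)
qed

text \<open>The asymptotic hypothesis enters only through \<open>4 k\<^sup>3 \<le> n\<close>.\<close>

lemma c_const_power_less:
  assumes k: "k \<ge> 2" and n: "4 * k ^ 3 \<le> n"
  shows "c_const k ^ n < real k * (real k - lambda_param n k) powr ((real n - 1) / 2)"
proof -
  define K N x where "K = real k" and "N = real n" and "x = (K - 1) / (N - 1)"
  have K: "K \<ge> 2" using k by (simp add: K_def)
  have N: "4 * K ^ 3 \<le> N"
    using of_nat_mono[OF n, where 'a = real] by (simp add: K_def N_def)
  have "K ^ 1 \<le> K ^ 3" using K by (intro power_increasing) auto
  then have NK: "2 * K \<le> N" using K N by simp
  have x: "x < 1" using K NK by (simp add: x_def)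
  have K2: "K\<^sup>2 > 1" using K by (simp add: one_less_power)
  have base: "K - lambda_param n k = K * (1 - x)"
    by (simp add: lambda_param_def x_def K_def N_def algebra_simps)
  have c_pos: "c_const k > 0"
    using K K2 less_imp_neq[OF K2] by (simp add: c_const_def K_def[symmetric])

  have "(1 - 1 / K) * ln (1 - 1 / K\<^sup>2) \<le> (1 - 1 / K) * (- (1 / K\<^sup>2))"
    using K K2 ln_le_minus_one[of "1 - 1 / K\<^sup>2"] by (intro mult_left_mono) auto
  also have "\<dots> = - ((K - 1) / K ^ 3)"
    using K by (simp add: field_simps power2_eq_square power3_eq_cube)
  finally have "N * ((1 - 1 / K) * ln (1 - 1 / K\<^sup>2)) \<le> N * - ((K - 1) / K ^ 3)"
    using K NK by (intro mult_left_mono) auto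
  then have gain: "N * ((1 - 1 / K) * ln (1 - 1 / K\<^sup>2) / 4) \<le> - (N * (K - 1) / (4 * K ^ 3))"
    by simp

  have "1 - x = (N - K) / (N - 1)"
    using K NK by (simp add: x_def field_simps)
  then have "x / (1 - x) = (K - 1) / (N - K)"
    using K NK by (simp add: x_def)
  with ln_one_minus_ge[OF x] have "- ((K - 1) / (N - K)) \<le> ln (1 - x)"
    by simp
  then have "(N - 1) / 2 * - ((K - 1) / (N - K)) \<le> (N - 1) / 2 * ln (1 - x)"
    using K NK by (intro mult_left_mono) auto
  then have loss: "- ((K - 1) * (N - 1) / (2 * (N - K))) \<le> (N - 1) / 2 * ln (1 - x)"
    by (simp add: mult.commute)

  have "ln (c_const k ^ n) = N * (ln K / 2) + N * ((1 - 1 / K) * ln (1 - 1 / K\<^sup>2) / 4)"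
    using c_pos by (simp add: ln_realpow ln_c_const[OF k] K_def N_def distrib_left)
  also have "\<dots> \<le> N * (ln K / 2) + (N - 1) / 2 * ln (1 - x)"
    using gain loss loss_le_gain[OF K N] by linarith
  also have "\<dots> < ln K + (N - 1) / 2 * (ln K + ln (1 - x))"
    using K ln_gt_zero[of K] by (simp add: field_simps)
  also have "\<dots> = ln (K * (K * (1 - x)) powr ((N - 1) / 2))"
    using K x by (simp add: ln_mult ln_powr)
  finally have "ln (c_const k ^ n) < ln (K * (K * (1 - x)) powr ((N - 1) / 2))" .
  then have "c_const k ^ n < K * (K * (1 - x)) powr ((N - 1) / 2)"
    using c_pos K x by (subst (asm) ln_less_cancel_iff) auto
  then show ?thesis
    by (simp add: base K_def[symmetric] N_def[symmetric])
qed

lemma eventually_4_mult_cube_le: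
  fixes k :: "nat \<Rightarrow> nat"
  assumes "(\<lambda>n. real (k n)) \<in> o(\<lambda>n. real n powr (1 / 3))"
  shows "\<forall>\<^sub>F n in sequentially. 4 * k n ^ 3 \<le> n"
proof -
  have "\<forall>\<^sub>F n in sequentially. norm (real (k n)) \<le> 1 / 2 * norm (real n powr (1 / 3))"
    using assms by (rule landau_o.smallD) simp
  then show ?thesis
  proof eventually_elim
    case (elim n)
    then have "real (k n) ^ 3 \<le> (1 / 2 * real n powr (1 / 3)) ^ 3"
      by (intro power_mono) auto
    also have "\<dots> = real n / 8"
      by (cases "n = 0") (simp_all add: power_mult_distrib power_divide powr_power)
    finally have "real (4 * k n ^ 3) \<le> real n" by simp
    then show ?case by (simp only: of_nat_le_iff)
  qed
qed

theorem theorem3p2: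
  fixes k :: "nat \<Rightarrow> nat"
  assumes k_range: "\<And>n. n \<ge> 1 \<Longrightarrow> 1 \<le> k n \<and> k n \<le> n"
    and k_small: "(\<lambda>n. real (k n)) \<in> o(\<lambda>n. real n powr (1 / 3))"
  shows "\<forall>\<^sub>F n in sequentially.
           c_const (k n) ^ n
             < real (k n) * (real (k n) - lambda_param n (k n)) powr ((real n - 1) / 2)"
  using eventually_4_mult_cube_le[OF k_small] eventually_ge_at_top[of 1]
proof eventually_elim
  case (elim n)
  show ?case
  proof (cases "k n = 1")
    case True
    \<comment> \<open>Here \<open>c_const 1 = 0\<close>, because \<open>powr\<close> with base \<open>0\<close> is \<open>0\<close> even at exponent \<open>0\<close>.\<close>
    then show ?thesis
      using elim by (simp add: c_const_def lambda_param_def power_0_left)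
  next
    case False
    then have "k n \<ge> 2" using k_range[OF elim(2)] by linarith
    then show ?thesis using elim(1) by (rule c_const_power_less)
  qed
qed

end
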